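(* Let $(X,d)$ be a metric space. For any subset $A\subseteq X$, $$L^*(A)\leq L_{MC}(A)\leq L_{IM}(A).$$ If $A$ is furthermore connected, then $L^*(A)=L_{MC}(A)=L_{IM}(A)$.
   Context: Conventions: $\sup\emptyset=0$, $\inf\emptyset=\infty$; all quantities below take values in $[0,\infty]$. Outer linear measure: for $A\subseteq X$, $\operatorname{diam}(A)=\sup\{d(a_1,a_2): a_1,a_2\in A\}$. A countable family $\{U_i: i\in\mathbb{N}\}$ of subsets of $X$ is a $\delta$-cover of $A$ if $\operatorname{diam}(U_i)\le\delta$ for all $i$ and $A\subseteq\bigcup_i U_i$. For $\delta>0$, $L^*_\delta(A)=\inf\{\sum_{i\in\mathbb{N}}\operatorname{diam}(U_i): \{U_i: i\in\mathbb{N}\}\text{ is a }\delta\text{-cover of }A\}$, and $L^*(A)=\sup_{\delta>0}L^*_\delta(A)=\lim_{\delta\to0}L^*_\delta(A)$. Graphs: a graph is a pair $G=(V,E)$ with $V$ a finite non-empty set and $E$ a set of two-element subsets of $V$; it is connected if any two vertices are the endpoints of a path in $G$. If $V\subseteq X$, the length of $G$ is $\ell(G)=\sum_{\{a,b\}\in E}d(a,b)$. For a finite non-empty $P\subseteq X$, $\operatorname{smt}(P)=\inf\{\ell(G): G=(V,E)\text{ is connected with }P\subseteq V\subseteq X\}$. For a finite non-empty $P\subseteq X$ and $A\subseteq X$, $\operatorname{smt}_A(P)=\inf\{\ell(G): G=(V,E)\text{ is connected with }P\subseteq V\text{ and }V\setminus P\subseteq A\}$. The Menger--Choquet length of $A\subseteq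 X$ is $L_{MC}(A)=\sup\{\operatorname{smt}(P): P\text{ is a finite non-empty subset of }A\}$. The intrinsic Menger length of $A\subseteq X$ is $L_{IM}(A)=\sup\{\operatorname{smt}_A(P): P\text{ is a finite non-empty subset of }A\}$. *)

theory Defs
  imports "HOL-Analysis.Analysis"
begin

text \<open>
  All lengths are extended nonnegative reals, so that \<open>Sup {} = 0\<close> and \<open>Inf {} = \<infinity>\<close>.
  The ambient metric space is the type \<open>'a\<close>.
\<close>

subsection \<open>Outer linear measure\<close>

text \<open>The library's \<open>diameter\<close> is real-valued and hence not meaningful on unbounded sets.\<close>

definition ediam :: "'a::metric_space set \<Rightarrow> ennreal" where
  "ediam A = Sup {ennreal (dist a b) | a b. a \<in> A \<and> b \<in> A}"

definition delta_cover :: "real \<Rightarrow> 'a::metric_space set \<Rightarrow> (nat \<Rightarrow> 'a set) \<Rightarrow> bool" where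
  "delta_cover \<delta> A U \<longleftrightarrow> (\<forall>i. ediam (U i) \<le> ennreal \<delta>) \<and> A \<subseteq> (\<Union>i. U i)"

definition outer_length_delta :: "real \<Rightarrow> 'a::metric_space set \<Rightarrow> ennreal" where
  "outer_length_delta \<delta> A = Inf {(\<Sum>i. ediam (U i)) | U. delta_cover \<delta> A U}"

definition outer_length :: "'a::metric_space set \<Rightarrow> ennreal" where
  "outer_length A = (SUP \<delta>\<in>{0<..}. outer_length_delta \<delta> A)"

lemma outer_length_delta_antimono:
  assumes "\<delta> \<le> \<epsilon>"
  shows "outer_length_delta \<epsilon> A \<le> outer_length_delta \<delta> A"
proof -
  have "delta_cover \<epsilon> A U" if "delta_cover \<delta> A U" for U
    using that assms unfolding delta_cover_def
    by (meson ennreal_leI order_trans)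
  then show ?thesis
    unfolding outer_length_delta_def by (intro Inf_superset_mono) blast
qed

lemma outer_length_tendsto:
  "((\<lambda>\<delta>. outer_length_delta \<delta> A) \<longlongrightarrow> outer_length A) (at_right 0)"
proof (rule order_tendstoI)
  fix a assume "a < outer_length A"
  then obtain \<epsilon> where "0 < \<epsilon>" "a < outer_length_delta \<epsilon> A"
    unfolding outer_length_def by (auto simp: less_SUP_iff)
  moreover have "\<forall>\<^sub>F \<delta> in at_right 0. \<delta> < \<epsilon>"
    using \<open>0 < \<epsilon>\<close> by (auto simp: eventually_at_right)
  ultimately show "\<forall>\<^sub>F \<delta> in at_right 0. a < outer_length_delta \<delta> A"
    by (elim eventually_mono) (meson less_le_trans less_imp_le outer_length_delta_antimono)
next
  fix a assume a: "outer_length A < a"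
  have "outer_length_delta \<delta> A < a" if "0 < \<delta>" for \<delta>
    using that a unfolding outer_length_def
    by (meson SUP_upper greaterThan_iff le_less_trans)
  then show "\<forall>\<^sub>F \<delta> in at_right 0. outer_length_delta \<delta> A < a"
    by (intro eventually_mono[OF eventually_at_right_less]) auto
qed

subsection \<open>Finite graphs and their length\<close>

definition fin_graph :: "'a set \<Rightarrow> 'a set set \<Rightarrow> bool" where
  "fin_graph V E \<longleftrightarrow> finite V \<and> V \<noteq> {} \<and> (\<forall>e\<in>E. e \<subseteq> V \<and> card e = 2)"

text \<open>A path is given by its nonempty list of pairwise distinct vertices.\<close>

definition graph_path :: "'a set \<Rightarrow> 'a set set \<Rightarrow> 'a \<Rightarrow> 'a list \<Rightarrow> 'a \<Rightarrow> bool" where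
  "graph_path V E u p v \<longleftrightarrow>
     p \<noteq> [] \<and> hd p = u \<and> last p = v \<and> set p \<subseteq> V \<and> distinct p \<and>
     successively (\<lambda>a b. {a, b} \<in> E) p"

definition connected_graph :: "'a set \<Rightarrow> 'a set set \<Rightarrow> bool" where
  "connected_graph V E \<longleftrightarrow>
     fin_graph V E \<and> (\<forall>u\<in>V. \<forall>v\<in>V. \<exists>p. graph_path V E u p v)"

definition edge_length :: "'a::metric_space set \<Rightarrow> real" where
  "edge_length e = (THE r. \<exists>a b. e = {a, b} \<and> r = dist a b)"

lemma edge_length_pair [simp]: "edge_length {a, b} = dist a b"
  unfolding edge_length_def
  by (rule the_equality) (auto simp: doubleton_eq_iff dist_commute)

definition graph_length :: "'a::metric_space set set \<Rightarrow> ennreal" where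
  "graph_length E = ennreal (\<Sum>e\<in>E. edge_length e)"

subsection \<open>Menger--Choquet length and intrinsic Menger length\<close>

definition smt :: "'a::metric_space set \<Rightarrow> ennreal" where
  "smt P = Inf {graph_length E | V E. connected_graph V E \<and> P \<subseteq> V}"

definition smt_in :: "'a::metric_space set \<Rightarrow> 'a set \<Rightarrow> ennreal" where
  "smt_in A P = Inf {graph_length E | V E. connected_graph V E \<and> P \<subseteq> V \<and> V - P \<subseteq> A}"

definition menger_choquet_length :: "'a::metric_space set \<Rightarrow> ennreal" where
  "menger_choquet_length A = (SUP P\<in>{P. finite P \<and> P \<noteq> {} \<and> P \<subseteq> A}. smt P)"

definition intrinsic_menger_length :: "'a::metric_space set \<Rightarrow> ennreal" where
  "intrinsic_menger_length A = (SUP P\<in>{P. finite P \<and> P \<noteq> {} \<and> P \<subseteq> A}. smt_in A P)"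

end

theory Submission imports Defs begin

text \<open>
  The inequality between the two Menger lengths holds because allowing more auxiliary vertices can
  only shorten a Steiner tree. The other two inequalities translate between covers and trees.

  Outer length is at most Menger--Choquet length. Let the latter be at most \<open>L < \<infinity>\<close>. A tree of
  length \<open>l\<close> can be cut greedily into at most about \<open>l / d\<close> pieces of diameter at most \<open>2 * d\<close> whose
  diameters add up to at most \<open>l\<close>. The bound on the number of pieces does two things. It bounds the
  number of points of a separated subset of \<open>A\<close>, so \<open>A\<close> is totally bounded; and it
  allows every piece to be thickened by a tiny \<open>s\<close> at a total cost of about \<open>s * l / d\<close>, which
  tends to \<open>0\<close> with \<open>s\<close> for fixed \<open>d\<close>. So a nearly optimal tree through a finite \<open>s / 2\<close>-net of \<open>A\<close>,
  cut into pieces and thickened, is a cover of \<open>A\<close> by small sets of total diameter close to \<open>L\<close>.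
  Both uses are recorded in one number, the cost \<open>\<Sum> (diam + s)\<close> of a cover; the key estimate
  is \<open>rooted_tree_cut\<close>.

  For connected \<open>A\<close>, the intrinsic Menger length is at most the outer length. Thicken an efficient
  cover of \<open>A\<close> by small sets to one by open sets. By connectedness, any two points of \<open>A\<close> are joined
  by a finite chain of cover sets, consecutive ones meeting in \<open>A\<close>. Given a finite \<open>P\<close>, connect its
  points one after the other: follow a chain from the graph built so far to the new point,
  paying one edge for each set of the chain, of length at most the diameter of that set. If the chain
  leaves the previously used sets for good after its first member, each cover set is paid for once, except
  for one extra small diameter per point of \<open>P\<close> (\<open>connected_graph_from_cover\<close>). As \<open>P\<close> is fixed,
  this excess vanishes as the cover gets finer.
\<close>

section \<open>Diameters and thickenings\<close>

lemma dist_le_ediam: "a \<in> U \<Longrightarrow> b \<in> U \<Longrightarrow> ennreal (dist a b) \<le> ediam U"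
  unfolding ediam_def by (intro Sup_upper) auto

lemma ediam_leI: "(\<And>a b. a \<in> U \<Longrightarrow> b \<in> U \<Longrightarrow> ennreal (dist a b) \<le> c) \<Longrightarrow> ediam U \<le> c"
  unfolding ediam_def by (intro Sup_least) auto

lemma ediam_empty [simp]: "ediam {} = 0"
  unfolding ediam_def by (simp add: bot_ennreal)

lemma ediam_singleton [simp]: "ediam {x} = 0"
  unfolding ediam_def by simp

lemma dist_le_if_ediam_le:
  assumes "ediam U \<le> ennreal t" "0 \<le> t" "a \<in> U" "b \<in> U"
  shows "dist a b \<le> t"
  using order_trans[OF dist_le_ediam[OF assms(3,4)] assms(1)] assms(2) by simp

lemma ediam_thickening_le:
  assumes "0 \<le> r"
  shows "ediam (\<Union>u\<in>U. ball u r) \<le> ediam U + ennreal (2 * r)"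
proof (rule ediam_leI)
  fix a b assume "a \<in> (\<Union>u\<in>U. ball u r)" "b \<in> (\<Union>u\<in>U. ball u r)"
  then obtain u v where uv: "u \<in> U" "v \<in> U" "dist u a < r" "dist v b < r"
    by auto
  have "dist a b \<le> dist u a + dist u v + dist v b"
    by (smt (verit) dist_commute dist_triangle)
  then have "dist a b \<le> dist u v + 2 * r"
    using uv by linarith
  then have "ennreal (dist a b) \<le> ennreal (dist u v) + ennreal (2 * r)"
    using assms by (metis ennreal_leI ennreal_plus mult_nonneg_nonneg zero_le_dist zero_le_numeral)
  also have "\<dots> \<le> ediam U + ennreal (2 * r)"
    by (intro add_right_mono dist_le_ediam uv)
  finally show "ennreal (dist a b) \<le> ediam U + ennreal (2 * r)" .
qed

lemma ediam_Un_le: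
  assumes "ediam R \<le> ennreal \<rho>" "ediam S \<le> ennreal \<sigma>" "0 \<le> \<rho>" "0 \<le> \<sigma>" "x \<in> R" "y \<in> S"
  shows "ediam (R \<union> S) \<le> ennreal (\<rho> + dist x y + \<sigma>)"
proof (rule ediam_leI, rule ennreal_leI)
  fix a b assume ab: "a \<in> R \<union> S" "b \<in> R \<union> S"
  have R: "dist u v \<le> \<rho>" if "u \<in> R" "v \<in> R" for u v
    using dist_le_if_ediam_le assms that by metis
  have S: "dist u v \<le> \<sigma>" if "u \<in> S" "v \<in> S" for u v
    using dist_le_if_ediam_le assms that by metis
  have RS: "dist u v \<le> \<rho> + dist x y + \<sigma>" if "u \<in> R" "v \<in> S" for u v
    using R[OF that(1) assms(5)] S[OF assms(6) that(2)] dist_triangle[of u v x] dist_triangle[of x v y]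
    by linarith
  have "\<rho> \<le> \<rho> + dist x y + \<sigma>" "\<sigma> \<le> \<rho> + dist x y + \<sigma>"
    using assms(3,4) by auto
  then show "dist a b \<le> \<rho> + dist x y + \<sigma>"
    using ab R[of a b] S[of a b] RS[of a b] RS[of b a] by (auto simp: dist_commute)
qed

section \<open>Cutting a tree into short pieces\<close>

text \<open>
  Trees with root \<open>r\<close>, vertex set \<open>V\<close> and length \<open>l\<close>. They are built by hanging one tree below the
  root of another, so that rule induction processes a tree from the leaves upwards, as the greedy
  cutting requires. The vertex sets joined may overlap; then \<open>l\<close> is merely an upper bound
  for the length of some tree on \<open>V\<close>.
\<close>

inductive rooted_tree :: "'a::metric_space \<Rightarrow> 'a set \<Rightarrow> real \<Rightarrow> bool" where
  point: "rooted_tree r {r} 0"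
| join: "rooted_tree r V l \<Longrightarrow> rooted_tree c W m \<Longrightarrow> rooted_tree r (V \<union> W) (l + m + dist r c)"

text \<open>
  The constructors only attach at the root; growing at an arbitrary vertex is what is
  needed to extract a spanning tree from a graph.
\<close>

lemma rooted_tree_grow:
  assumes "rooted_tree r V l" "v \<in> V"
  shows "rooted_tree r (insert y V) (l + dist v y)"
  using assms
proof (induction rule: rooted_tree.induct)
  case (point r)
  then show ?case
    using rooted_tree.join[OF rooted_tree.point[of r] rooted_tree.point[of y]]
    by (simp add: insert_commute)
next
  case (join r V l c W m)
  consider "v \<in> V" | "v \<in> W" using join.prems by auto
  then show ?case
  proof cases
    case 1
    then show ?thesis
      using rooted_tree.join[OF join.IH(1)[OF 1] join.hyps(2)] by (simp add: algebra_simps)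
  next
    case 2
    then show ?thesis
      using rooted_tree.join[OF join.hyps(1) join.IH(2)[OF 2]] by (simp add: algebra_simps)
  qed
qed

lemma successively_leaves_set:
  assumes "successively Q p" "p \<noteq> []" "hd p \<in> S" "last p \<notin> S"
  shows "\<exists>a\<in>S. \<exists>b. b \<notin> S \<and> Q a b"
  using assms by (induction p rule: induct_list012) auto

lemma edge_length_nonneg:
  assumes "card e = 2"
  shows "0 \<le> edge_length e"
  using assms by (auto simp: card_2_iff)

lemma fin_graph_finite_edges: "fin_graph V E \<Longrightarrow> finite E"
  unfolding fin_graph_def by (meson Pow_iff finite_Pow_iff finite_subset subsetI)

lemma connected_graph_spanning_tree:
  assumes G: "connected_graph V E" and r: "r \<in> V"
  obtains l where "rooted_tree r V l" "l \<le> (\<Sum>e\<in>E. edge_length e)"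
proof -
  have FG: "fin_graph V E" using G unfolding connected_graph_def by simp
  have finE: "finite E" by (rule fin_graph_finite_edges[OF FG])
  have fin: "finite V" and E: "\<And>e. e \<in> E \<Longrightarrow> e \<subseteq> V \<and> card e = 2"
    using FG unfolding fin_graph_def by auto
  \<comment> \<open>A largest vertex set carrying a tree inside the graph is all of \<open>V\<close>: otherwise some edge leaves it.\<close>
  define good where "good S \<longleftrightarrow> S \<subseteq> V \<and> r \<in> S \<and>
    (\<exists>l. rooted_tree r S l \<and> l \<le> (\<Sum>e\<in>{e\<in>E. e \<subseteq> S}. edge_length e))" for S
  have "good {r}"
    unfolding good_def using r rooted_tree.point[of r] E
    by (auto intro!: exI[of _ 0] sum_nonneg edge_length_nonneg)
  moreover have "\<forall>S. good S \<longrightarrow> card S < Suc (card V)"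
    unfolding good_def less_Suc_eq_le using fin card_mono by blast
  ultimately have "\<exists>S. good S \<and> (\<forall>T. good T \<longrightarrow> card T \<le> card S)"
    by (rule ex_has_greatest_nat)
  then obtain S where S: "good S" and max: "\<And>T. good T \<Longrightarrow> card T \<le> card S"
    by blast
  have SV: "S \<subseteq> V" and rS: "r \<in> S" and finS: "finite S"
    using S fin finite_subset unfolding good_def by auto
  obtain l where l: "rooted_tree r S l" "l \<le> (\<Sum>e\<in>{e\<in>E. e \<subseteq> S}. edge_length e)"
    using S unfolding good_def by auto
  have "S = V"
  proof (rule ccontr)
    assume "S \<noteq> V"
    then obtain y where y: "y \<in> V" "y \<notin> S" using SV by auto
    obtain p where "graph_path V E r p y"
      using G r y unfolding connected_graph_def by blast
    then obtain a b where ab: "a \<in> S" "b \<notin> S" "{a, b} \<in> E"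
      using successively_leaves_set[of "\<lambda>a b. {a, b} \<in> E" p S] rS y
      unfolding graph_path_def by auto
    have "l + dist a b \<le> (\<Sum>e\<in>insert {a,b} {e\<in>E. e \<subseteq> S}. edge_length e)"
      using l(2) ab finE by simp
    also have "\<dots> \<le> (\<Sum>e\<in>{e\<in>E. e \<subseteq> insert b S}. edge_length e)"
      using ab finE E by (intro sum_mono2) (auto intro: edge_length_nonneg)
    finally have "good (insert b S)"
      unfolding good_def using rooted_tree_grow[OF l(1) ab(1), of b] SV rS E[OF ab(3)] by blast
    then show False
      using max[of "insert b S"] ab finS by simp
  qed
  moreover have "{e\<in>E. e \<subseteq> V} = E" using E by auto
  ultimately show ?thesis using that l by simp
qed

text \<open>
  A cover whose members are charged their diameter plus a fixed fee \<open>s\<close>. The fee pays for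
  thickening each member by \<open>s / 2\<close>, and it also bounds the number of members. Lists rather than sets
  of pieces make costs additive under concatenation.
\<close>

definition covered_at_cost :: "real \<Rightarrow> real \<Rightarrow> 'a::metric_space set \<Rightarrow> real \<Rightarrow> bool" where
  "covered_at_cost d s V c \<longleftrightarrow> 0 \<le> c \<and>
     (\<exists>Ws. V \<subseteq> \<Union>(set Ws) \<and> (\<forall>W\<in>set Ws. ediam W \<le> ennreal d) \<and>
        (\<Sum>W\<leftarrow>Ws. ediam W + ennreal s) \<le> ennreal c)"

lemma covered_at_cost_empty: "covered_at_cost d s {} 0"
  unfolding covered_at_cost_def by (auto intro: exI[of _ "[]"])

lemma covered_at_cost_mono:
  assumes "covered_at_cost d s V c" "W \<subseteq> V" "c \<le> c'"
  shows "covered_at_cost d s W c'"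
  using assms unfolding covered_at_cost_def
  by (meson dual_order.trans ennreal_leI)

lemma covered_at_cost_Un:
  assumes "covered_at_cost d s V c" "covered_at_cost d s W c'"
  shows "covered_at_cost d s (V \<union> W) (c + c')"
proof -
  obtain Vs where Vs: "V \<subseteq> \<Union>(set Vs)" "\<forall>W\<in>set Vs. ediam W \<le> ennreal d"
      "(\<Sum>W\<leftarrow>Vs. ediam W + ennreal s) \<le> ennreal c" "0 \<le> c"
    using assms(1) unfolding covered_at_cost_def by auto
  obtain Ws where Ws: "W \<subseteq> \<Union>(set Ws)" "\<forall>W\<in>set Ws. ediam W \<le> ennreal d"
      "(\<Sum>W\<leftarrow>Ws. ediam W + ennreal s) \<le> ennreal c'" "0 \<le> c'"
    using assms(2) unfolding covered_at_cost_def by auto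
  have "(\<Sum>W\<leftarrow>Vs @ Ws. ediam W + ennreal s) \<le> ennreal (c + c')"
    using add_mono[OF Vs(3) Ws(3)] Vs(4) Ws(4) by simp
  then show ?thesis
    unfolding covered_at_cost_def using Vs Ws
    by (intro conjI exI[of _ "Vs @ Ws"]) auto
qed

lemma covered_at_cost_piece:
  assumes "ediam W \<le> ennreal t" "0 \<le> t" "t \<le> d" "0 \<le> s"
  shows "covered_at_cost d s W (t + s)"
proof -
  have "ediam W \<le> ennreal d"
    using assms ennreal_leI order_trans by blast
  moreover have "ediam W + ennreal s \<le> ennreal (t + s)"
    using assms by (simp add: add_right_mono)
  ultimately show ?thesis
    unfolding covered_at_cost_def using assms by (intro conjI exI[of _ "[W]"]) auto
qed

text \<open>
  The greedy cutting. A residual piece \<open>R\<close> of diameter at most \<open>\<rho> < d\<close> around the root is kept open,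
  and everything else is already cut off. The length not accounted for by \<open>R\<close> pays for the
  pieces cut off at the rate \<open>1 + s / d\<close>: a piece is closed only when length \<open>t \<ge> d\<close> has
  accumulated, and then \<open>t + s \<le> (1 + s / d) * t\<close>.
\<close>

lemma rooted_tree_cut:
  assumes "rooted_tree r V l" and d: "0 < d" and s: "0 \<le> s"
  shows "\<exists>R \<rho> c. r \<in> R \<and> ediam R \<le> ennreal \<rho> \<and> 0 \<le> \<rho> \<and> \<rho> < d \<and>
           covered_at_cost (2 * d) s (V - R) c \<and> c + (1 + s / d) * \<rho> \<le> (1 + s / d) * l"
  using assms(1)
proof (induction rule: rooted_tree.induct)
  case (point r)
  show ?case
    using d by (intro exI[of _ "{r}"] exI[of _ 0]) (auto simp: covered_at_cost_empty)
next
  case (join r V l x W m)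
  define k where "k = 1 + s / d"
  have kge: "t + s \<le> k * t" if "d \<le> t" for t
  proof -
    have "s * d \<le> s * t" using that s by (rule mult_left_mono)
    then have "s \<le> s / d * t" using d by (simp add: field_simps)
    then show ?thesis unfolding k_def by (simp add: algebra_simps)
  qed
  have k1: "1 \<le> k" unfolding k_def using d s by simp
  obtain R \<rho> c where R: "r \<in> R" "ediam R \<le> ennreal \<rho>" "0 \<le> \<rho>" "\<rho> < d"
      "covered_at_cost (2 * d) s (V - R) c" "c + k * \<rho> \<le> k * l"
    using join.IH(1) unfolding k_def by blast
  obtain S \<sigma> b where S: "x \<in> S" "ediam S \<le> ennreal \<sigma>" "0 \<le> \<sigma>" "\<sigma> < d"
      "covered_at_cost (2 * d) s (W - S) b" "b + k * \<sigma> \<le> k * m"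
    using join.IH(2) unfolding k_def by blast
  define w where "w = dist r x"
  have w: "0 \<le> w" unfolding w_def by simp
  have RS: "ediam (R \<union> S) \<le> ennreal (\<rho> + w + \<sigma>)"
    unfolding w_def using R S by (intro ediam_Un_le) auto
  have rest: "covered_at_cost (2 * d) s ((V - R) \<union> (W - S)) (c + b)"
    by (intro covered_at_cost_Un R S)
  \<comment> \<open>In turn: the subtree's residue together with the joining edge is long enough to be cut off, the
    edge itself being dropped; the two residues merge into a short one; or the merged residue has
    length between \<open>d\<close> and \<open>2 * d\<close> and is cut off, leaving only the root.\<close>
  consider "d \<le> w + \<sigma>" | "\<rho> + w + \<sigma> < d" | "w + \<sigma> < d" "d \<le> \<rho> + w + \<sigma>"
    by linarith
  then have "\<exists>R \<rho> c. r \<in> R \<and> ediam R \<le> ennreal \<rho> \<and> 0 \<le> \<rho> \<and> \<rho> < d \<and>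
      covered_at_cost (2 * d) s (V \<union> W - R) c \<and> c + k * \<rho> \<le> k * (l + m + w)"
  proof cases
    case 1
    have "covered_at_cost (2 * d) s S (\<sigma> + s)"
      using S d s by (intro covered_at_cost_piece) auto
    from covered_at_cost_Un[OF rest this]
    have "covered_at_cost (2 * d) s (V \<union> W - R) (c + b + (\<sigma> + s))"
      by (rule covered_at_cost_mono) auto
    moreover have "c + b + (\<sigma> + s) + k * \<rho> \<le> k * (l + m + w)"
      using kge[OF 1] R(6) S(6) w by (simp add: algebra_simps)
    ultimately show ?thesis using R by blast
  next
    case 2
    have "covered_at_cost (2 * d) s (V \<union> W - (R \<union> S)) (c + b)"
      by (rule covered_at_cost_mono[OF rest]) auto
    moreover have "c + b + k * (\<rho> + w + \<sigma>) \<le> k * (l + m + w)"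
      using R(6) S(6) by (simp add: algebra_simps)
    ultimately show ?thesis using R S w RS 2
      by (intro exI[of _ "R \<union> S"] exI[of _ "\<rho> + w + \<sigma>"] exI[of _ "c + b"]) auto
  next
    case 3
    have "covered_at_cost (2 * d) s (R \<union> S) (\<rho> + w + \<sigma> + s)"
      using RS R S w 3 s by (intro covered_at_cost_piece) auto
    from covered_at_cost_Un[OF rest this]
    have "covered_at_cost (2 * d) s (V \<union> W - {r}) (c + b + (\<rho> + w + \<sigma> + s))"
      by (rule covered_at_cost_mono) auto
    moreover have "c + b + (\<rho> + w + \<sigma> + s) \<le> k * (l + m + w)"
      using kge[OF 3(2)] R(6) S(6) by (simp add: algebra_simps)
    ultimately show ?thesis using d
      by (intro exI[of _ "{r}"] exI[of _ "0::real"] exI[of _ "c + b + (\<rho> + w + \<sigma> + s)"]) auto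
  qed
  then show ?case unfolding k_def w_def .
qed

lemma connected_graph_covered_at_cost:
  assumes G: "connected_graph V E" and d: "0 < d" and s: "0 \<le> s"
  shows "covered_at_cost (2 * d) s V ((1 + s / d) * (\<Sum>e\<in>E. edge_length e) + s)"
proof -
  define k where "k = 1 + s / d"
  have k1: "1 \<le> k" unfolding k_def using d s by simp
  obtain r where "r \<in> V"
    using G unfolding connected_graph_def fin_graph_def by auto
  then obtain l where l: "rooted_tree r V l" "l \<le> (\<Sum>e\<in>E. edge_length e)"
    using connected_graph_spanning_tree[OF G] by blast
  obtain R \<rho> c where R: "ediam R \<le> ennreal \<rho>" "0 \<le> \<rho>" "\<rho> < d"
      "covered_at_cost (2 * d) s (V - R) c" "c + k * \<rho> \<le> k * l"
    using rooted_tree_cut[OF l(1) d s] unfolding k_def by blast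
  have "covered_at_cost (2 * d) s R (\<rho> + s)"
    using R d s by (intro covered_at_cost_piece) auto
  moreover have "c + (\<rho> + s) \<le> k * (\<Sum>e\<in>E. edge_length e) + s"
  proof -
    have "\<rho> \<le> k * \<rho>" using k1 R(2) mult_right_mono[of 1 k \<rho>] by simp
    moreover have "k * l \<le> k * (\<Sum>e\<in>E. edge_length e)"
      using l(2) k1 by (intro mult_left_mono) auto
    ultimately show ?thesis using R(5) by linarith
  qed
  ultimately show ?thesis
    using covered_at_cost_mono[OF covered_at_cost_Un[OF R(4)]] unfolding k_def by blast
qed

text \<open>Each piece contains at most one of the separated points, and pays a fee of \<open>s\<close>.\<close>

lemma covered_at_cost_card_le:
  assumes V: "covered_at_cost d s V c" and "finite P" "P \<subseteq> V" and d: "0 \<le> d" and s: "0 \<le> s"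
    and sep: "\<And>x y. x \<in> P \<Longrightarrow> y \<in> P \<Longrightarrow> x \<noteq> y \<Longrightarrow> d < dist x y"
  shows "real (card P) * s \<le> c"
proof -
  obtain Ws where Ws: "V \<subseteq> \<Union>(set Ws)" "\<forall>W\<in>set Ws. ediam W \<le> ennreal d"
      "(\<Sum>W\<leftarrow>Ws. ediam W + ennreal s) \<le> ennreal c" "0 \<le> c"
    using V unfolding covered_at_cost_def by auto
  have one: "card (P \<inter> W) \<le> 1" if "W \<in> set Ws" for W
  proof -
    have "x = y" if "x \<in> P \<inter> W" "y \<in> P \<inter> W" for x y
      using sep[of x y] dist_le_if_ediam_le[of W d x y] Ws(2) \<open>W \<in> set Ws\<close> that d by fastforce
    then show ?thesis
      using \<open>finite P\<close> by (auto simp: card_le_Suc0_iff_eq)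
  qed
  have "P = (\<Union>W\<in>set Ws. P \<inter> W)" using Ws(1) \<open>P \<subseteq> V\<close> by auto
  then have "card P \<le> (\<Sum>W\<in>set Ws. card (P \<inter> W))"
    by (metis card_UN_le List.finite_set)
  also have "\<dots> \<le> card (set Ws)"
    using sum_mono[of "set Ws" "\<lambda>W. card (P \<inter> W)" "\<lambda>_. 1"] one by simp
  also have "\<dots> \<le> length Ws" by (rule card_length)
  finally have "real (card P) * s \<le> real (length Ws) * s"
    using s by (intro mult_right_mono) auto
  moreover have "ennreal (real (length Ws) * s) = (\<Sum>W\<leftarrow>Ws. ennreal s)"
    using s by (simp add: sum_list_triv ennreal_mult ennreal_of_nat_eq_real_of_nat)
  moreover have "(\<Sum>W\<leftarrow>Ws. ennreal s) \<le> (\<Sum>W\<leftarrow>Ws. ediam W + ennreal s)"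
    by (intro sum_list_mono) simp
  ultimately have "ennreal (real (card P) * s) \<le> ennreal c"
    using Ws(3) by (metis (no_types, lifting) ennreal_leI order_trans)
  then show ?thesis using Ws(4) by simp
qed

lemma covered_at_cost_outer_length_delta:
  assumes V: "covered_at_cost d s V c" and d: "0 \<le> d" and s: "0 \<le> s"
    and A: "A \<subseteq> (\<Union>v\<in>V. ball v (s / 2))"
  shows "outer_length_delta (d + s) A \<le> ennreal c"
proof -
  obtain Ws where Ws: "V \<subseteq> \<Union>(set Ws)" "\<forall>W\<in>set Ws. ediam W \<le> ennreal d"
      "(\<Sum>W\<leftarrow>Ws. ediam W + ennreal s) \<le> ennreal c"
    using V unfolding covered_at_cost_def by auto
  define U where "U i = (if i < length Ws then \<Union>w\<in>Ws ! i. ball w (s / 2) else {})" for i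
  have U: "ediam (U i) \<le> ediam (Ws ! i) + ennreal s" if "i < length Ws" for i
    using ediam_thickening_le[of "s / 2" "Ws ! i"] that s unfolding U_def by simp
  have "ediam (U i) \<le> ennreal (d + s)" for i
  proof (cases "i < length Ws")
    case True
    then have "ediam (U i) \<le> ennreal d + ennreal s"
      using U[OF True] Ws(2) add_right_mono order_trans by (metis nth_mem)
    then show ?thesis using d s by simp
  qed (simp add: U_def)
  moreover have "A \<subseteq> (\<Union>i. U i)"
  proof
    fix a assume "a \<in> A"
    then obtain v W where "v \<in> W" "W \<in> set Ws" "a \<in> ball v (s / 2)"
      using A Ws(1) by blast
    then show "a \<in> (\<Union>i. U i)"
      unfolding U_def in_set_conv_nth by auto
  qed
  ultimately have "outer_length_delta (d + s) A \<le> (\<Sum>i. ediam (U i))"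
    unfolding outer_length_delta_def delta_cover_def by (intro Inf_lower) blast
  also have "\<dots> = (\<Sum>i<length Ws. ediam (U i))"
    by (intro suminf_finite) (auto simp: U_def)
  also have "\<dots> \<le> (\<Sum>i<length Ws. ediam (Ws ! i) + ennreal s)"
    by (intro sum_mono U) simp
  also have "\<dots> = (\<Sum>W\<leftarrow>Ws. ediam W + ennreal s)"
    by (simp add: sum_list_sum_nth atLeast0LessThan)
  finally show ?thesis using Ws(3) by simp
qed

section \<open>Outer length is at most Menger--Choquet length\<close>

lemma near_optimal_graph:
  assumes P: "finite P" "P \<noteq> {}" "P \<subseteq> A"
    and L: "menger_choquet_length A \<le> ennreal L" "0 \<le> L" and e: "0 < e"
  obtains V E where "connected_graph V E" "P \<subseteq> V" "(\<Sum>e\<in>E. edge_length e) \<le> L + e"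
proof -
  have "smt P \<le> menger_choquet_length A"
    unfolding menger_choquet_length_def using P by (intro SUP_upper) auto
  also have "\<dots> < ennreal (L + e)"
    using L e by (smt (verit) ennreal_less_iff le_less_trans)
  finally obtain V E where G: "connected_graph V E" "P \<subseteq> V" "graph_length E < ennreal (L + e)"
    unfolding smt_def Inf_less_iff by auto
  have "(\<Sum>e\<in>E. edge_length e) \<le> L + e"
    using less_imp_le[OF G(3)] L(2) e unfolding graph_length_def by (subst (asm) ennreal_le_iff) auto
  then show ?thesis using that G by blast
qed

text \<open>
  A largest \<open>r\<close>-separated subset is a net. It exists since such sets have bounded size: a graph of
  length about \<open>L\<close> through an \<open>r\<close>-separated set is covered by a bounded number of pieces of diameter
  less than \<open>r\<close>.
\<close>

lemma finite_net_if_menger_choquet_finite: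
  assumes L: "menger_choquet_length A \<le> ennreal L" "0 \<le> L" and A: "A \<noteq> {}" and r: "0 < r"
  obtains P where "finite P" "P \<noteq> {}" "P \<subseteq> A" "A \<subseteq> (\<Union>p\<in>P. ball p r)"
proof -
  define sep where "sep P \<longleftrightarrow> finite P \<and> P \<noteq> {} \<and> P \<subseteq> A \<and>
    (\<forall>x\<in>P. \<forall>y\<in>P. x \<noteq> y \<longrightarrow> r \<le> dist x y)" for P
  \<comment> \<open>The cutting bound for \<open>d = s = r / 4\<close>: the pieces have diameter at most \<open>r / 2 < r\<close>, the factor
    \<open>1 + s / d\<close> is \<open>2\<close>, and each piece costs at least \<open>r / 4\<close>.\<close>
  define N where "N = nat \<lceil>(2 * (L + 1) + r / 4) / (r / 4)\<rceil>"
  have bound: "\<forall>P. sep P \<longrightarrow> card P < Suc N"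
  proof (intro allI impI)
    fix P assume "sep P"
    have P: "finite P" "P \<noteq> {}" "P \<subseteq> A" "\<And>x y. x \<in> P \<Longrightarrow> y \<in> P \<Longrightarrow> x \<noteq> y \<Longrightarrow> r \<le> dist x y"
      using \<open>sep P\<close> unfolding sep_def by auto
    obtain V E where G: "connected_graph V E" "P \<subseteq> V" "(\<Sum>e\<in>E. edge_length e) \<le> L + 1"
      using near_optimal_graph[OF P(1-3) L zero_less_one] by blast
    have "covered_at_cost (2 * (r / 4)) (r / 4) V
        ((1 + (r / 4) / (r / 4)) * (\<Sum>e\<in>E. edge_length e) + r / 4)"
      using r by (intro connected_graph_covered_at_cost[OF G(1)]) auto
    then have "covered_at_cost (2 * (r / 4)) (r / 4) V (2 * (L + 1) + r / 4)"
      by (rule covered_at_cost_mono) (use G(3) r in auto)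
    then have "card P * (r / 4) \<le> 2 * (L + 1) + r / 4"
    proof (rule covered_at_cost_card_le[OF _ P(1) G(2)])
      show "2 * (r / 4) < dist x y" if "x \<in> P" "y \<in> P" "x \<noteq> y" for x y
        using P(4)[OF that] r by simp
    qed (use r in auto)
    then have "card P \<le> (2 * (L + 1) + r / 4) / (r / 4)"
      using r by (simp add: field_simps)
    then show "card P < Suc N" unfolding N_def by linarith
  qed
  obtain a where "a \<in> A" using A by auto
  then have "sep {a}" unfolding sep_def by auto
  then have "\<exists>P. sep P \<and> (\<forall>Q. sep Q \<longrightarrow> card Q \<le> card P)"
    using bound by (rule ex_has_greatest_nat)
  then obtain P where P: "sep P" and max: "\<And>Q. sep Q \<Longrightarrow> card Q \<le> card P"
    by blast
  have "A \<subseteq> (\<Union>p\<in>P. ball p r)"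
  proof (rule ccontr)
    assume "\<not> A \<subseteq> (\<Union>p\<in>P. ball p r)"
    then obtain x where x: "x \<in> A" "\<And>p. p \<in> P \<Longrightarrow> r \<le> dist p x"
      by (meson UN_I mem_ball not_le subsetI)
    have "x \<notin> P" using x(2)[of x] r by auto
    moreover have "sep (insert x P)"
      using P x unfolding sep_def by (auto simp: dist_commute)
    ultimately show False
      using max[of "insert x P"] P unfolding sep_def by auto
  qed
  then show ?thesis using that[of P] P unfolding sep_def by simp
qed

text \<open>
  The scale \<open>d\<close> of the pieces is fixed while the mesh \<open>s / 2\<close> of the net tends to \<open>0\<close>, so that the
  factor \<open>1 + s / d\<close> disappears.
\<close>

lemma outer_length_delta_le_menger_choquet:
  assumes L: "menger_choquet_length A \<le> ennreal L" "0 \<le> L" and A: "A \<noteq> {}" and d: "0 < d"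
  shows "outer_length_delta (3 * d) A \<le> ennreal L"
proof (rule ennreal_le_epsilon)
  fix e :: real assume e: "0 < e"
  \<comment> \<open>The cost bound \<open>(1 + s / d) * (L + e / 2) + s\<close> equals \<open>L + e / 2 + s * q\<close>; hence the choice of \<open>s\<close>.\<close>
  define q where "q = (L + e / 2) / d + 1"
  define s where "s = min d (e / (2 * q))"
  have q: "0 < q" unfolding q_def using L d e by (simp add: add_nonneg_pos)
  have s: "0 < s" "s \<le> d" "s * q \<le> e / 2"
    unfolding s_def using d e q by (auto simp: min_def field_simps)
  obtain P where P: "finite P" "P \<noteq> {}" "P \<subseteq> A" "A \<subseteq> (\<Union>p\<in>P. ball p (s / 2))"
    using finite_net_if_menger_choquet_finite[OF L A, of "s / 2"] s by auto
  obtain V E where G: "connected_graph V E" "P \<subseteq> V" "(\<Sum>e\<in>E. edge_length e) \<le> L + e / 2"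
    using near_optimal_graph[OF P(1-3) L, of "e / 2"] e by auto
  have "covered_at_cost (2 * d) s V ((1 + s / d) * (\<Sum>e\<in>E. edge_length e) + s)"
    using connected_graph_covered_at_cost[OF G(1)] d s by simp
  moreover have "(1 + s / d) * (\<Sum>e\<in>E. edge_length e) + s \<le> L + e"
  proof -
    have "(1 + s / d) * (\<Sum>e\<in>E. edge_length e) \<le> (1 + s / d) * (L + e / 2)"
      using G(3) s d by (intro mult_left_mono) auto
    then have "(1 + s / d) * (\<Sum>e\<in>E. edge_length e) + s \<le> (1 + s / d) * (L + e / 2) + s"
      by (rule add_right_mono)
    also have "\<dots> = L + e / 2 + s * q"
      unfolding q_def using d by (simp add: algebra_simps add_divide_distrib)
    also have "\<dots> \<le> L + e" using s(3) by simp
    finally show ?thesis .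
  qed
  ultimately have "covered_at_cost (2 * d) s V (L + e)"
    using covered_at_cost_mono by blast
  then have "outer_length_delta (2 * d + s) A \<le> ennreal (L + e)"
    by (rule covered_at_cost_outer_length_delta) (use P(4) G(2) d s in auto)
  moreover have "outer_length_delta (3 * d) A \<le> outer_length_delta (2 * d + s) A"
    using s(2) by (intro outer_length_delta_antimono) simp
  ultimately show "outer_length_delta (3 * d) A \<le> ennreal L + ennreal e"
    using L(2) e by simp
qed

lemma outer_length_delta_empty: "outer_length_delta d {} = 0"
proof -
  have "delta_cover d {} (\<lambda>_. {})"
    unfolding delta_cover_def by simp
  then have "outer_length_delta d {} \<le> (\<Sum>i::nat. ediam ({}::'a set))"
    unfolding outer_length_delta_def by (intro Inf_lower) (auto intro!: exI[of _ "\<lambda>_. {}"])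
  then show ?thesis by simp
qed

lemma outer_length_le_menger_choquet: "outer_length A \<le> menger_choquet_length A"
proof (cases "A = {} \<or> menger_choquet_length A = \<infinity>")
  case True
  then show ?thesis
    by (auto simp: outer_length_def outer_length_delta_empty)
next
  case False
  then obtain L where L: "menger_choquet_length A = ennreal L" "0 \<le> L"
    by (metis ennreal_cases infinity_ennreal_def)
  have "outer_length_delta d A \<le> ennreal L" if "0 < d" for d
    using outer_length_delta_le_menger_choquet[of A L "d / 3"] L False that by simp
  then show ?thesis
    unfolding outer_length_def L(1) by (intro SUP_least) simp
qed

section \<open>Connected sets\<close>

text \<open>
  Cutting a chain at its last visit to \<open>I\<close>, and cutting out its loops, makes all its members
  after the first one new and pairwise distinct. Applied to cover sets, only the first set of a
  chain can then have been paid for before.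
\<close>

lemma rtranclp_to_chain:
  assumes "rel\<^sup>*\<^sup>* i j" "i \<in> I"
  shows "\<exists>js. js \<noteq> [] \<and> hd js \<in> I \<and> last js = j \<and> successively rel js \<and> distinct js \<and> set (tl js) \<inter> I = {}"
  using assms
proof (induction rule: rtranclp_induct)
  case base
  then show ?case by (intro exI[of _ "[i]"]) auto
next
  case (step j k)
  then obtain js where js: "js \<noteq> []" "hd js \<in> I" "last js = j" "successively rel js"
      "distinct js" "set (tl js) \<inter> I = {}"
    by blast
  consider "k \<in> I" | "k \<in> set js" | "k \<notin> I" "k \<notin> set js" by blast
  then show ?case
  proof cases
    case 1
    then show ?thesis by (intro exI[of _ "[k]"]) auto
  next
    case 2
    then obtain xs ys where "js = (xs @ [k]) @ ys"
      by (metis append.assoc append_Cons append_Nil split_list)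
    moreover from this have "successively rel (xs @ [k])"
      using js(4) by (simp only: successively_append_iff[of rel "xs @ [k]"])
    ultimately show ?thesis
      using js by (intro exI[of _ "xs @ [k]"]) (cases xs, auto)
  next
    case 3
    then show ?thesis
      using js step.hyps(2) by (intro exI[of _ "js @ [k]"]) (auto simp: successively_append_iff)
  qed
qed

text \<open>
  The sets reachable from \<open>U i\<close> and the remaining ones have unions that are open and
  disjoint within \<open>A\<close>; as \<open>A\<close> is connected, the former cover \<open>A\<close>.
\<close>

lemma connected_cover_chain:
  assumes A: "connected A" and op: "\<And>i. open (U i)" and cov: "A \<subseteq> (\<Union>i. U i)"
    and i: "A \<inter> U i \<noteq> {}" and p: "p \<in> A"
  obtains j where "(\<lambda>i j. A \<inter> U i \<inter> U j \<noteq> {})\<^sup>*\<^sup>* i j" "p \<in> U j"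
proof -
  define J where "J = {j. (\<lambda>i j. A \<inter> U i \<inter> U j \<noteq> {})\<^sup>*\<^sup>* i j}"
  have cl: "k \<in> J" if "j \<in> J" "x \<in> A" "x \<in> U j" "x \<in> U k" for j k x
    using that unfolding J_def by (auto intro!: rtranclp.rtrancl_into_rtrancl[of _ i j k])
  have "i \<in> J" unfolding J_def by simp
  have "(\<Union>j\<in>J. U j) \<inter> A = {} \<or> (\<Union>j\<in>-J. U j) \<inter> A = {}"
  proof (rule connectedD[OF A])
    show "(\<Union>j\<in>J. U j) \<inter> (\<Union>j\<in>-J. U j) \<inter> A = {}" using cl by blast
    show "A \<subseteq> (\<Union>j\<in>J. U j) \<union> (\<Union>j\<in>-J. U j)" using cov by blast
  qed (auto intro: op)
  then have "(\<Union>j\<in>-J. U j) \<inter> A = {}" using i \<open>i \<in> J\<close> by blast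
  then obtain j where "j \<in> J" "p \<in> U j" using p cov by blast
  then show ?thesis using that unfolding J_def by blast
qed

lemma graph_path_rev:
  assumes "graph_path V E u p v"
  shows "graph_path V E v (rev p) u"
  using assms unfolding graph_path_def
  by (auto simp: hd_rev last_rev insert_commute)

lemma connected_graph_insert:
  assumes G: "connected_graph V E" and v: "v \<in> V" and y: "y \<notin> V"
  shows "connected_graph (insert y V) (insert {v, y} E)"
proof -
  have V: "fin_graph V E" and path: "\<And>u w. u \<in> V \<Longrightarrow> w \<in> V \<Longrightarrow> \<exists>p. graph_path V E u p w"
    using G unfolding connected_graph_def by auto
  have fg: "fin_graph (insert y V) (insert {v, y} E)"
    using V v y unfolding fin_graph_def by (auto simp: card_insert_if)
  have old: "graph_path (insert y V) (insert {v, y} E) u p w" if "graph_path V E u p w" for u p w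
    using that unfolding graph_path_def by (auto elim: successively_mono)
  have new: "\<exists>p. graph_path (insert y V) (insert {v, y} E) y p w" if w: "w \<in> V" for w
  proof -
    obtain p where p: "graph_path V E v p w" using path[OF v w] by blast
    then have "graph_path (insert y V) (insert {v, y} E) y (y # p) w"
      using old[OF p] y unfolding graph_path_def by (auto simp: successively_Cons insert_commute)
    then show ?thesis by blast
  qed
  have yy: "graph_path (insert y V) (insert {v, y} E) y [y] y"
    unfolding graph_path_def by simp
  have "\<exists>p. graph_path (insert y V) (insert {v, y} E) u p w"
    if "u \<in> insert y V" "w \<in> insert y V" for u w
    using that path old new yy graph_path_rev by (metis insert_iff)
  then show ?thesis using fg unfolding connected_graph_def by blast
qed

lemma connected_graph_singleton: "connected_graph {x} {}"
proof -
  have "graph_path {x} {} x [x] x" unfolding graph_path_def by simp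
  then show ?thesis unfolding connected_graph_def fin_graph_def by auto
qed

lemma connected_graph_extend:
  assumes G: "connected_graph V E" and v: "v \<in> V"
  obtains E' where "connected_graph (insert y V) E'"
    "graph_length E' \<le> graph_length E + ennreal (dist v y)"
proof (cases "y \<in> V")
  case True
  then show ?thesis using that[of E] G by (simp add: insert_absorb)
next
  case False
  have FG: "fin_graph V E" using G unfolding connected_graph_def by simp
  have E: "finite E" "\<And>e. e \<in> E \<Longrightarrow> e \<subseteq> V \<and> card e = 2"
    using fin_graph_finite_edges[OF FG] FG unfolding fin_graph_def by auto
  then have "(\<Sum>e\<in>insert {v, y} E. edge_length e) = (\<Sum>e\<in>E. edge_length e) + dist v y"
    using False by (subst sum.insert) auto
  moreover have "0 \<le> (\<Sum>e\<in>E. edge_length e)"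
    using E by (intro sum_nonneg edge_length_nonneg) auto
  ultimately have "graph_length (insert {v, y} E) \<le> graph_length E + ennreal (dist v y)"
    unfolding graph_length_def by simp
  then show ?thesis using that connected_graph_insert[OF G v False] by blast
qed

text \<open>
  Inside each set of the chain one edge is drawn, from a vertex already present to a point shared with
  the next set (in the last set, to \<open>p\<close>).
\<close>

lemma connected_graph_extend_along_chain:
  assumes "connected_graph V E" "V \<subseteq> A" "js \<noteq> []" "V \<inter> U (hd js) \<noteq> {}"
    "successively (\<lambda>i j. A \<inter> U i \<inter> U j \<noteq> {}) js" "p \<in> A" "p \<in> U (last js)"
  shows "\<exists>V' E'. connected_graph V' E' \<and> V \<subseteq> V' \<and> V' \<subseteq> A \<and> p \<in> V' \<and>
    (\<forall>j\<in>set js. V' \<inter> U j \<noteq> {}) \<and>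
    graph_length E' \<le> graph_length E + (\<Sum>j\<leftarrow>js. ediam (U j))"
  using assms
proof (induction js arbitrary: V E rule: induct_list012)
  case (2 j)
  then obtain v where v: "v \<in> V" "v \<in> U j" by auto
  obtain E' where E': "connected_graph (insert p V) E'"
      "graph_length E' \<le> graph_length E + ennreal (dist v p)"
    using connected_graph_extend[OF 2(1) v(1)] by blast
  have "graph_length E' \<le> graph_length E + ediam (U j)"
    using E'(2) dist_le_ediam[of v "U j" p] v 2 by (auto intro: order_trans add_left_mono)
  then show ?case
    using 2 v E' by (intro exI[of _ "insert p V"] exI[of _ E']) auto
next
  case (3 j k js)
  then obtain v where v: "v \<in> V" "v \<in> U j" by auto
  obtain y where y: "y \<in> A" "y \<in> U j" "y \<in> U k" using 3 by auto
  obtain E' where E': "connected_graph (insert y V) E'"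
      "graph_length E' \<le> graph_length E + ennreal (dist v y)"
    using connected_graph_extend[OF 3(3) v(1)] by blast
  have E'j: "graph_length E' \<le> graph_length E + ediam (U j)"
    using E'(2) dist_le_ediam[OF v(2) y(2)] by (meson add_left_mono order_trans)
  have "\<exists>V' E''. connected_graph V' E'' \<and> insert y V \<subseteq> V' \<and> V' \<subseteq> A \<and> p \<in> V' \<and>
    (\<forall>j\<in>set (k # js). V' \<inter> U j \<noteq> {}) \<and>
    graph_length E'' \<le> graph_length E' + (\<Sum>j\<leftarrow>k # js. ediam (U j))"
    using 3 y E' by (intro "3.IH"(2)) auto
  then obtain V' E'' where V': "connected_graph V' E''" "insert y V \<subseteq> V'" "V' \<subseteq> A" "p \<in> V'"
    "\<forall>j\<in>set (k # js). V' \<inter> U j \<noteq> {}"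
    "graph_length E'' \<le> graph_length E' + (\<Sum>j\<leftarrow>k # js. ediam (U j))"
    by blast
  have "graph_length E'' \<le> (graph_length E + ediam (U j)) + (\<Sum>j\<leftarrow>k # js. ediam (U j))"
    using V'(6) add_right_mono[OF E'j] order_trans by blast
  then show ?case
    using V' v by (intro exI[of _ V'] exI[of _ E'']) (auto simp: add.assoc)
qed simp

text \<open>
  \<open>I\<close> collects the cover sets paid for so far; each of them contains a vertex, so a chain may
  start at any of them. That first set may be paid for again, which costs at most \<open>h\<close> for each point
  of \<open>P\<close>; the other sets of the chain are new.
\<close>

lemma connected_graph_from_cover:
  fixes U :: "nat \<Rightarrow> 'a::metric_space set"
  assumes A: "connected A" and op: "\<And>i. open (U i)" and cov: "A \<subseteq> (\<Union>i. U i)"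
    and h: "\<And>i. ediam (U i) \<le> h"
    and P: "finite P" "P \<noteq> {}" "P \<subseteq> A"
  shows "\<exists>V E I. connected_graph V E \<and> P \<subseteq> V \<and> V \<subseteq> A \<and> finite I \<and> I \<noteq> {} \<and>
    (\<forall>i\<in>I. V \<inter> U i \<noteq> {}) \<and>
    graph_length E \<le> (\<Sum>i\<in>I. ediam (U i)) + of_nat (card P) * h"
  using P
proof (induction rule: finite_ne_induct)
  case (singleton p)
  then obtain i where "p \<in> U i" using cov by auto
  then show ?case
    using singleton connected_graph_singleton[of p]
    by (intro exI[of _ "{p}"] exI[of _ "{}"] exI[of _ "{i}"]) (auto simp: graph_length_def)
next
  case (insert p P)
  then obtain V E I where V: "connected_graph V E" "P \<subseteq> V" "V \<subseteq> A" "finite I" "I \<noteq> {}"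
    "\<forall>i\<in>I. V \<inter> U i \<noteq> {}" "graph_length E \<le> (\<Sum>i\<in>I. ediam (U i)) + of_nat (card P) * h"
    by auto
  obtain i where i: "i \<in> I" using V by blast
  then have "A \<inter> U i \<noteq> {}" using V by blast
  then obtain j where j: "(\<lambda>i j. A \<inter> U i \<inter> U j \<noteq> {})\<^sup>*\<^sup>* i j" "p \<in> U j"
    using connected_cover_chain[OF A op cov, of i p] insert.prems by auto
  obtain js where js: "js \<noteq> []" "hd js \<in> I" "last js = j"
      "successively (\<lambda>i j. A \<inter> U i \<inter> U j \<noteq> {}) js" "distinct js" "set (tl js) \<inter> I = {}"
    using rtranclp_to_chain[OF j(1) i] by blast
  obtain V' E' where V': "connected_graph V' E'" "V \<subseteq> V'" "V' \<subseteq> A" "p \<in> V'"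
    "\<forall>j\<in>set js. V' \<inter> U j \<noteq> {}"
    "graph_length E' \<le> graph_length E + (\<Sum>j\<leftarrow>js. ediam (U j))"
    using connected_graph_extend_along_chain[OF V(1,3) js(1) _ js(4), of p] V(6) js j insert.prems
    by auto
  have hdtl: "js = hd js # tl js" using js(1) by simp
  have "(\<Sum>j\<leftarrow>js. ediam (U j)) = ediam (U (hd js)) + (\<Sum>j\<leftarrow>tl js. ediam (U j))"
    by (subst hdtl) simp
  also have "(\<Sum>j\<leftarrow>tl js. ediam (U j)) = (\<Sum>j\<in>set (tl js). ediam (U j))"
    using js(5) by (simp add: sum_list_distinct_conv_sum_set distinct_tl)
  finally have "(\<Sum>j\<leftarrow>js. ediam (U j)) \<le> h + (\<Sum>j\<in>set (tl js). ediam (U j))"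
    using h by (simp add: add_right_mono)
  then have "graph_length E' \<le> ((\<Sum>i\<in>I. ediam (U i)) + of_nat (card P) * h)
      + (h + (\<Sum>j\<in>set (tl js). ediam (U j)))"
    using V'(6) V(7) by (meson add_mono order_trans)
  also have "\<dots> = (\<Sum>i\<in>I \<union> set (tl js). ediam (U i)) + of_nat (card (insert p P)) * h"
    using js(6) V(4) insert.hyps by (subst sum.union_disjoint) (auto simp: algebra_simps)
  finally have "graph_length E' \<le> (\<Sum>i\<in>I \<union> set (tl js). ediam (U i)) + of_nat (card (insert p P)) * h" .
  moreover have "\<forall>i\<in>I \<union> set (tl js). V' \<inter> U i \<noteq> {}"
    using V(6) V'(2,5) by (auto dest: list.set_sel(2)[OF js(1)])
  ultimately show ?case
    using V V' by (intro exI[of _ V'] exI[of _ E'] exI[of _ "I \<union> set (tl js)"]) auto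
qed

lemma smt_in_le_outer_length:
  fixes A :: "'a::metric_space set"
  assumes A: "connected A" and P: "finite P" "P \<noteq> {}" "P \<subseteq> A"
  shows "smt_in A P \<le> outer_length A"
proof (rule ennreal_le_epsilon)
  fix e :: real assume fin: "outer_length A < top" and e: "0 < e"
  \<comment> \<open>The excess over the outer length is \<open>k\<close> for choosing the cover, \<open>k\<close> for thickening it, and
    \<open>k + k\<close>, the bound on the diameters of the thickened sets, for every point of \<open>P\<close>.\<close>
  define k where "k = e / (2 * (real (card P) + 1))"
  have "k * (2 * (real (card P) + 1)) = e"
    unfolding k_def by simp
  then have k: "0 < k" "k + k + card P * (k + k) = e"
    unfolding k_def using e by (simp, simp only: algebra_simps mult_2)
  have "outer_length_delta k A \<le> outer_length A"
    unfolding outer_length_def using k by (intro SUP_upper) auto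
  also have "\<dots> < outer_length A + ennreal k"
    using fin k by (cases "outer_length A") (auto simp flip: ennreal_plus simp: ennreal_less_iff)
  finally obtain U where U: "\<And>i. ediam (U i) \<le> ennreal k" "A \<subseteq> (\<Union>i. U i)"
      "(\<Sum>i. ediam (U i)) < outer_length A + ennreal k"
    unfolding outer_length_delta_def Inf_less_iff delta_cover_def by auto
  define r where "r i = k * (1 / 2) ^ Suc i / 2" for i
  define W where "W i = (\<Union>u\<in>U i. ball u (r i))" for i
  have r: "0 < r i" "2 * r i \<le> k" for i
    unfolding r_def using k power_le_one[of "1/2::real" "Suc i"] by auto
  have W: "ediam (W i) \<le> ediam (U i) + ennreal (2 * r i)" for i
    unfolding W_def using r(1)[of i] by (intro ediam_thickening_le) simp
  have Wh: "ediam (W i) \<le> ennreal (k + k)" for i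
  proof -
    have "ediam (W i) \<le> ennreal k + ennreal k"
      using W[of i] U(1)[of i] r(2)[of i] by (meson add_mono ennreal_leI order_trans)
    then show ?thesis using k(1) by (subst ennreal_plus) auto
  qed
  have rsum: "(\<Sum>i. ennreal (2 * r i)) = ennreal k"
  proof -
    have "(\<lambda>i. k * (1 / 2) ^ Suc i) sums (k * 1)"
      by (intro sums_mult power_half_series)
    then have "(\<lambda>i. 2 * r i) sums k" unfolding r_def by simp
    then show ?thesis using r(1) by (intro suminf_ennreal_eq) (auto intro: less_imp_le)
  qed
  have "U i \<subseteq> W i" for i
    unfolding W_def using r(1) by (auto intro: centre_in_ball[THEN iffD2])
  then have cov: "A \<subseteq> (\<Union>i. W i)"
    using U(2) by (meson SUP_mono' order_trans)
  have "open (W i)" for i unfolding W_def by auto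
  then obtain V E I where V: "connected_graph V E" "P \<subseteq> V" "V \<subseteq> A" "finite I"
    "graph_length E \<le> (\<Sum>i\<in>I. ediam (W i)) + of_nat (card P) * ennreal (k + k)"
    using connected_graph_from_cover[OF A _ cov Wh P] by blast
  have "(\<Sum>i\<in>I. ediam (W i)) \<le> (\<Sum>i. ediam (W i))"
    using V(4) by (intro sum_le_suminf) auto
  also have "\<dots> \<le> (\<Sum>i. ediam (U i) + ennreal (2 * r i))"
    using W by (intro suminf_le) auto
  also have "\<dots> = (\<Sum>i. ediam (U i)) + ennreal k"
    by (subst suminf_add[symmetric]) (auto simp: rsum)
  also have "\<dots> \<le> outer_length A + ennreal k + ennreal k"
    using U(3) by (intro add_right_mono) simp
  finally have "graph_length E \<le> outer_length A + ennreal k + ennreal k + of_nat (card P) * ennreal (k + k)"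
    using V(5) by (meson add_right_mono order_trans)
  also have "\<dots> = outer_length A + ennreal (k + k + card P * (k + k))"
  proof -
    have "ennreal (k + k + card P * (k + k)) = ennreal (k + k) + ennreal (card P * (k + k))"
      using k(1) by (intro ennreal_plus) auto
    moreover have "ennreal (k + k) = ennreal k + ennreal k"
      using k(1) by (intro ennreal_plus) auto
    moreover have "ennreal (card P * (k + k)) = of_nat (card P) * ennreal (k + k)"
      using k(1) by (subst ennreal_mult) (auto simp: ennreal_of_nat_eq_real_of_nat)
    ultimately show ?thesis by (simp only: add.assoc)
  qed
  finally have "graph_length E \<le> outer_length A + ennreal e" unfolding k(2) .
  moreover have "smt_in A P \<le> graph_length E"
    unfolding smt_in_def using V by (intro Inf_lower) blast
  ultimately show "smt_in A P \<le> outer_length A + ennreal e" by (rule order_trans[rotated])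
qed

section \<open>Comparison of the three lengths\<close>

lemma smt_le_smt_in: "smt P \<le> smt_in A P"
  unfolding smt_def smt_in_def by (intro Inf_superset_mono) blast

lemma menger_choquet_le_intrinsic_menger: "menger_choquet_length A \<le> intrinsic_menger_length A"
  unfolding menger_choquet_length_def intrinsic_menger_length_def
  by (intro SUP_mono') (rule smt_le_smt_in)

lemma intrinsic_menger_le_outer_length:
  "connected A \<Longrightarrow> intrinsic_menger_length A \<le> outer_length A"
  unfolding intrinsic_menger_length_def by (intro SUP_least) (auto intro: smt_in_le_outer_length)

theorem theorem1:
  fixes A :: "'a::metric_space set"
  shows "outer_length A \<le> menger_choquet_length A \<and>
         menger_choquet_length A \<le> intrinsic_menger_length A \<and>
         (connected A \<longrightarrow>
            outer_length A = menger_choquet_length A \<and>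
            menger_choquet_length A = intrinsic_menger_length A)"
  using outer_length_le_menger_choquet[of A] menger_choquet_le_intrinsic_menger[of A]
    intrinsic_menger_le_outer_length[of A]
  by (auto intro: order.antisym order.trans)

end
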